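(* For any range map $\delta$, the product $\cdot$ of $\mathbf{Cl}_\delta$ satisfies, for any $u, v \in \mathsf{Cl}_\delta$: if $u / v \in \mathsf{Cl}_\delta$, then $$\mathsf{F}_u \cdot \mathsf{F}_v = \sum_{\substack{w \in \mathsf{Cl}_\delta\\ u / v \,\preccurlyeq\, w \,\preccurlyeq\, u \backslash v}} \mathsf{F}_w,$$ and if $u / v \notin \mathsf{Cl}_\delta$, then $\mathsf{F}_u \cdot \mathsf{F}_v = 0$.
   Context: A range map is a map $\delta : \mathbb{N}\setminus\{0\} \to \mathbb{N}$ (with $0 \in \mathbb{N}$). A $\delta$-cliff of size $n$ is a word $u = u_1 \cdots u_n$ of integers with $0 \leq u_i \leq \delta(i)$ for all $1 \leq i \leq n$; $\mathsf{Cl}_\delta(n)$ is the set of $\delta$-cliffs of size $n$ and $\mathsf{Cl}_\delta = \bigsqcup_{n\geq 0} \mathsf{Cl}_\delta(n)$; $|u|$ is the size of $u$. Words of the same length are compared by $u \preccurlyeq v$ iff $u_i \leq v_i$ for all $i$. Let $\mathbb{K}$ be a field of characteristic zero. $\mathbf{Cl}_\delta$ is the $\mathbb{K}$-vector space with basis $\{\mathsf{F}_u : u \in \mathsf{Cl}_\delta\}$. For $n \geq 0$, $\mathrm{r}_\delta : \mathbb{N}^n \to \mathsf{Cl}_\delta(n)$ is defined by $\mathrm{r}_\delta(u)_i := \min\{u_i, \delta(i)\}$. The bilinear product $\cdot$ is defined by $$\mathsf{F}_u \cdot \mathsf{F}_v = \sum_{\substack{v' \in \mathrm{r}_\delta^{-1}(v)\\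 uv' \in \mathsf{Cl}_\delta}} \mathsf{F}_{uv'},$$ where $uv'$ is the concatenation. For $u, v \in \mathsf{Cl}_\delta$, $u / v := uv$ (concatenation) and $u \backslash v := uv'$, where $v'$ is the word of length $|v|$ with $v'_i = \delta(|u|+i)$ if $v_i = \delta(i)$, and $v'_i = v_i$ otherwise. *)

theory Defs
  imports Complex_Main "HOL-Library.Poly_Mapping"
begin

section \<open>Cliffs\<close>

text \<open>
  Words are lists of naturals. They are indexed from 1 in the mathematics and from 0 here, so the
  \<open>i\<close>-th letter of a list is bounded by \<open>\<delta> (Suc i)\<close>. Range maps live on the positive integers: the
  value \<open>\<delta> 0\<close> is never used.
\<close>

definition cliffs :: "(nat \<Rightarrow> nat) \<Rightarrow> nat list set" where
  "cliffs \<delta> = {u. \<forall>i<length u. u ! i \<le> \<delta> (Suc i)}"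

definition word_le :: "nat list \<Rightarrow> nat list \<Rightarrow> bool"  (infix \<open>\<preceq>\<close> 50) where
  "u \<preceq> v \<longleftrightarrow> length u = length v \<and> (\<forall>i<length u. u ! i \<le> v ! i)"

definition cliff_red :: "(nat \<Rightarrow> nat) \<Rightarrow> nat list \<Rightarrow> nat list" where
  "cliff_red \<delta> u = map (\<lambda>i. min (u ! i) (\<delta> (Suc i))) [0..<length u]"

definition cliff_over :: "nat list \<Rightarrow> nat list \<Rightarrow> nat list" where
  "cliff_over u v = u @ v"

definition cliff_under :: "(nat \<Rightarrow> nat) \<Rightarrow> nat list \<Rightarrow> nat list \<Rightarrow> nat list" where
  "cliff_under \<delta> u v =
     u @ map (\<lambda>i. if v ! i = \<delta> (Suc i) then \<delta> (length u + Suc i) else v ! i) [0..<length v]"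


section \<open>The space of cliffs and its product\<close>

text \<open>
  Formal linear combinations of words are finitely supported functions \<open>nat list \<Rightarrow>\<^sub>0 'k\<close>; the space
  attached to \<open>\<delta>\<close> consists of those supported on \<open>\<delta>\<close>-cliffs.
\<close>

definition cliff_space :: "(nat \<Rightarrow> nat) \<Rightarrow> (nat list \<Rightarrow>\<^sub>0 'k::field_char_0) set" where
  "cliff_space \<delta> = {x. Poly_Mapping.keys x \<subseteq> cliffs \<delta>}"

definition FF :: "nat list \<Rightarrow> (nat list \<Rightarrow>\<^sub>0 'k::field_char_0)" where
  "FF u = Poly_Mapping.single u 1"

definition scale :: "'k \<Rightarrow> (nat list \<Rightarrow>\<^sub>0 'k) \<Rightarrow> (nat list \<Rightarrow>\<^sub>0 'k::field_char_0)" where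
  "scale c x = Poly_Mapping.map ((*) c) x"

text \<open>
  As \<open>cliff_red \<delta>\<close> preserves length, the words \<open>v'\<close> below all have the length of \<open>v\<close>; the index set is
  finite. The product is the bilinear extension to all words, and it takes its values in
  \<open>cliff_space \<delta>\<close>; it is zero on pairs of words that are not both cliffs.
\<close>

definition cliff_basis_mult :: "(nat \<Rightarrow> nat) \<Rightarrow> nat list \<Rightarrow> nat list \<Rightarrow> (nat list \<Rightarrow>\<^sub>0 'k::field_char_0)"
  where "cliff_basis_mult \<delta> u v = (\<Sum>v' | cliff_red \<delta> v' = v \<and> u @ v' \<in> cliffs \<delta>. FF (u @ v'))"

definition cliff_mult ::
    "(nat \<Rightarrow> nat) \<Rightarrow> (nat list \<Rightarrow>\<^sub>0 'k) \<Rightarrow> (nat list \<Rightarrow>\<^sub>0 'k) \<Rightarrow> (nat list \<Rightarrow>\<^sub>0 'k::field_char_0)" where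
  "cliff_mult \<delta> x y =
     (\<Sum>u\<in>Poly_Mapping.keys x. \<Sum>v\<in>Poly_Mapping.keys y.
        scale (Poly_Mapping.lookup x u * Poly_Mapping.lookup y v) (cliff_basis_mult \<delta> u v))"


section \<open>Well-definedness\<close>

lemma finite_cliffs_length: "finite {w \<in> cliffs \<delta>. length w = n}"
proof -
  define M where "M = (\<Sum>i\<le>n. \<delta> i)"
  have "{w \<in> cliffs \<delta>. length w = n} \<subseteq> {w. set w \<subseteq> {..M} \<and> length w = n}"
  proof safe
    fix w k assume w: "w \<in> cliffs \<delta>" "n = length w" and k: "k \<in> set w"
    then obtain i where i: "i < length w" "k = w ! i" by (auto simp: in_set_conv_nth)
    then have "k \<le> \<delta> (Suc i)" using w by (auto simp: cliffs_def)
    also have "\<dots> \<le> M" unfolding M_def using i w by (intro member_le_sum) auto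
    finally show "k \<le> M" .
  qed
  then show ?thesis by (rule finite_subset) (simp add: finite_lists_length_eq)
qed

lemma length_cliff_red [simp]: "length (cliff_red \<delta> u) = length u"
  by (simp add: cliff_red_def)

lemma cliff_red_in_cliffs: "cliff_red \<delta> u \<in> cliffs \<delta>"
  by (simp add: cliffs_def cliff_red_def)

lemma finite_mult_support: "finite {v'. cliff_red \<delta> v' = v \<and> u @ v' \<in> cliffs \<delta>}"
proof -
  have "(@) u ` {v'. cliff_red \<delta> v' = v \<and> u @ v' \<in> cliffs \<delta>}
          \<subseteq> {w \<in> cliffs \<delta>. length w = length u + length v}" by auto
  then have "finite ((@) u ` {v'. cliff_red \<delta> v' = v \<and> u @ v' \<in> cliffs \<delta>})"
    using finite_cliffs_length by (rule finite_subset)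
  then show ?thesis by (rule finite_imageD) (simp add: inj_on_def)
qed

lemma finite_interval: "finite {w \<in> cliffs \<delta>. a \<preceq> w \<and> w \<preceq> b}"
  by (rule finite_subset[OF _ finite_cliffs_length[of \<delta> "length a"]]) (auto simp: word_le_def)

lemma lookup_scale [simp]: "Poly_Mapping.lookup (scale c x) u = c * Poly_Mapping.lookup x u"
  unfolding scale_def by transfer (simp add: when_def)

lemma vector_space_scale: "vector_space (scale :: 'k::field_char_0 \<Rightarrow> _)"
  by unfold_locales (auto intro!: poly_mapping_eqI simp: lookup_add algebra_simps)

lemma subspace_cliff_space: "module.subspace scale (cliff_space \<delta>)"
proof -
  interpret vector_space "scale :: 'a \<Rightarrow> _" by (rule vector_space_scale)
  show ?thesis
    by (rule subspaceI)
      (auto simp: cliff_space_def in_keys_iff lookup_add subset_iff, metis add.right_neutral)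
qed

lemma expand_FF: "x = (\<Sum>u\<in>Poly_Mapping.keys x. scale (Poly_Mapping.lookup x u) (FF u))"
  by (rule poly_mapping_eqI)
    (auto simp: lookup_sum FF_def lookup_single when_def if_distrib in_keys_iff cong: if_cong)

lemma span_FF: "module.span scale (FF ` cliffs \<delta>) = cliff_space \<delta>"
proof -
  interpret vector_space "scale :: 'a \<Rightarrow> _" by (rule vector_space_scale)
  show ?thesis
  proof
    show "span (FF ` cliffs \<delta>) \<subseteq> cliff_space \<delta>"
      by (rule span_minimal[OF _ subspace_cliff_space]) (auto simp: cliff_space_def FF_def)
    show "cliff_space \<delta> \<subseteq> span (FF ` cliffs \<delta>)"
    proof
      fix x :: "nat list \<Rightarrow>\<^sub>0 'a" assume "x \<in> cliff_space \<delta>"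
      then have "(\<Sum>u\<in>Poly_Mapping.keys x. scale (Poly_Mapping.lookup x u) (FF u))
                   \<in> span (FF ` cliffs \<delta>)"
        by (intro span_sum span_scale span_base imageI) (auto simp: cliff_space_def)
      then show "x \<in> span (FF ` cliffs \<delta>)" by (simp flip: expand_FF)
    qed
  qed
qed

lemma inj_FF: "inj FF"
  by (auto simp: FF_def inj_def poly_mapping_eq_iff fun_eq_iff lookup_single when_def split: if_splits)

lemma independent_FF: "\<not> module.dependent scale (FF ` cliffs \<delta>)"
proof -
  interpret vector_space "scale :: 'a \<Rightarrow> _" by (rule vector_space_scale)
  show ?thesis
    unfolding independent_explicit_module
  proof (intro allI impI)
    fix T :: "(nat list \<Rightarrow>\<^sub>0 'a) set" and c b
    assume T: "finite T" "T \<subseteq> FF ` cliffs \<delta>" "(\<Sum>b\<in>T. scale (c b) b) = 0" "b \<in> T"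
    then obtain w where w: "b = FF w" by auto
    have "0 = Poly_Mapping.lookup (\<Sum>b\<in>T. scale (c b) b) w" using T by simp
    also have "\<dots> = (\<Sum>b'\<in>T. if b' = b then c b' else 0)"
      unfolding lookup_sum
    proof (intro sum.cong refl)
      fix b' assume "b' \<in> T"
      then obtain w' where "b' = FF w'" using T by auto
      moreover from this have "b' = b \<longleftrightarrow> w' = w" using w by (simp add: inj_eq[OF inj_FF])
      ultimately show "Poly_Mapping.lookup (scale (c b') b') w = (if b' = b then c b' else 0)"
        by (simp add: FF_def lookup_single when_def)
    qed
    also have "\<dots> = c b" using T by simp
    finally show "c b = 0" by simp
  qed
qed

lemma cliff_mult_FF: "cliff_mult \<delta> (FF u) (FF v) = cliff_basis_mult \<delta> u v"
  by (rule poly_mapping_eqI) (simp add: cliff_mult_def FF_def)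

lemma cliff_mult_FF_eq_0:
  assumes "u \<notin> cliffs \<delta> \<or> v \<notin> cliffs \<delta>"
  shows "cliff_mult \<delta> (FF u) (FF v) = 0"
proof -
  have "u \<in> cliffs \<delta>" if "u @ v' \<in> cliffs \<delta>" for v'
    unfolding cliffs_def
  proof (intro CollectI allI impI)
    fix i assume i: "i < length u"
    then have "(u @ v') ! i \<le> \<delta> (Suc i)" using that by (simp add: cliffs_def)
    then show "u ! i \<le> \<delta> (Suc i)" using i by (simp add: nth_append)
  qed
  then have "{v'. cliff_red \<delta> v' = v \<and> u @ v' \<in> cliffs \<delta>} = {}"
    using assms cliff_red_in_cliffs by blast
  then show ?thesis by (simp only: cliff_mult_FF cliff_basis_mult_def sum.empty)
qed

lemma cliff_mult_eq:
  assumes "finite A" "finite B" "Poly_Mapping.keys x \<subseteq> A" "Poly_Mapping.keys y \<subseteq> B"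
  shows "cliff_mult \<delta> x y = (\<Sum>u\<in>A. \<Sum>v\<in>B.
     scale (Poly_Mapping.lookup x u * Poly_Mapping.lookup y v) (cliff_basis_mult \<delta> u v))"
proof -
  interpret vector_space "scale :: 'a \<Rightarrow> _" by (rule vector_space_scale)
  show ?thesis unfolding cliff_mult_def
    by (rule sum.mono_neutral_cong_left)
      (use assms in \<open>auto simp: in_keys_iff intro!: sum.mono_neutral_left\<close>)
qed

lemma cliff_mult_add_left: "cliff_mult \<delta> (x + y) z = cliff_mult \<delta> x z + cliff_mult \<delta> y z"
proof -
  interpret vector_space "scale :: 'a \<Rightarrow> _" by (rule vector_space_scale)
  let ?A = "Poly_Mapping.keys x \<union> Poly_Mapping.keys y" and ?B = "Poly_Mapping.keys z"
  show ?thesis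
    by (subst (1 2 3) cliff_mult_eq[of ?A ?B])
      (auto simp: keys_add lookup_add distrib_right scale_left_distrib sum.distrib
        intro: subsetD[OF keys_add])
qed

lemma cliff_mult_add_right: "cliff_mult \<delta> z (x + y) = cliff_mult \<delta> z x + cliff_mult \<delta> z y"
proof -
  interpret vector_space "scale :: 'a \<Rightarrow> _" by (rule vector_space_scale)
  let ?A = "Poly_Mapping.keys x \<union> Poly_Mapping.keys y" and ?B = "Poly_Mapping.keys z"
  show ?thesis
    by (subst (1 2 3) cliff_mult_eq[of ?B ?A])
      (auto simp: keys_add lookup_add distrib_left scale_left_distrib sum.distrib
        intro: subsetD[OF keys_add])
qed

lemma cliff_mult_scale_left: "cliff_mult \<delta> (scale c x) y = scale c (cliff_mult \<delta> x y)"
proof -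
  interpret vector_space "scale :: 'a \<Rightarrow> _" by (rule vector_space_scale)
  show ?thesis
    by (subst (1 2) cliff_mult_eq[of "Poly_Mapping.keys x" "Poly_Mapping.keys y"])
      (auto simp: in_keys_iff scale_sum_right mult_ac)
qed

lemma cliff_mult_scale_right: "cliff_mult \<delta> x (scale c y) = scale c (cliff_mult \<delta> x y)"
proof -
  interpret vector_space "scale :: 'a \<Rightarrow> _" by (rule vector_space_scale)
  show ?thesis
    by (subst (1 2) cliff_mult_eq[of "Poly_Mapping.keys x" "Poly_Mapping.keys y"])
      (auto simp: in_keys_iff scale_sum_right mult_ac)
qed

lemma cliff_mult_closed: "cliff_mult \<delta> x y \<in> cliff_space \<delta>"
proof -
  interpret vector_space "scale :: 'a \<Rightarrow> _" by (rule vector_space_scale)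
  show ?thesis unfolding cliff_mult_def cliff_basis_mult_def
    by (intro subspace_sum subspace_scale subspace_cliff_space) (auto simp: cliff_space_def FF_def)
qed

end

theory Submission
  imports Defs
begin

text \<open>
  Everything happens letter by letter. Let \<open>d = \<delta> i\<close> and let \<open>e\<close> be the bound at the place that the
  \<open>i\<close>-th letter of the second factor takes after concatenation. A letter \<open>a \<le> e\<close> is truncated by
  \<open>min a d\<close> to a given \<open>b < d\<close> only if \<open>a = b\<close>, and to \<open>b = d\<close> exactly if \<open>d \<le> a\<close>. In both cases the
  letters over \<open>b\<close> are those of the interval from \<open>b\<close> to the corresponding letter of
  \<open>cliff_under\<close>. Hence the words that index the product, with \<open>u\<close> put in front, are precisely the
  cliffs between \<open>u / v\<close> and \<open>u \ v\<close> (\<open>cliff_red_eq_iff_interval\<close>).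

  Truncation only decreases letters and cliffs are closed downwards, so \<open>u / v\<close> is a cliff as soon
  as one summand exists (\<open>cliff_over_in_cliffs\<close>). If it is not, the product is an empty sum.
\<close>

lemma word_le_nthD: "u \<preceq> v \<Longrightarrow> i < length u \<Longrightarrow> u ! i \<le> v ! i"
  by (simp add: word_le_def)

lemma word_le_append_same_prefix: "u @ v \<preceq> u @ v' \<longleftrightarrow> v \<preceq> v'"
proof
  assume le: "u @ v \<preceq> u @ v'"
  then have len: "length v = length v'" by (simp add: word_le_def)
  have "v ! i \<le> v' ! i" if "i < length v" for i
    using word_le_nthD[OF le, of "length u + i"] that by simp
  with len show "v \<preceq> v'" by (simp add: word_le_def)
next
  assume "v \<preceq> v'"
  then show "u @ v \<preceq> u @ v'" by (auto simp: word_le_def nth_append)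
qed

lemma cliffs_downward_closed:
  assumes "v \<in> cliffs \<delta>" and "u \<preceq> v"
  shows "u \<in> cliffs \<delta>"
  unfolding cliffs_def
proof (intro CollectI allI impI)
  fix i assume i: "i < length u"
  then have "u ! i \<le> v ! i" using assms(2) by (simp add: word_le_def)
  also have "v ! i \<le> \<delta> (Suc i)" using assms i by (simp add: cliffs_def word_le_def)
  finally show "u ! i \<le> \<delta> (Suc i)" .
qed

lemma cliffs_append_nth_le:
  assumes "u @ v \<in> cliffs \<delta>" and "i < length v"
  shows "v ! i \<le> \<delta> (length u + Suc i)"
proof -
  have "\<forall>j<length (u @ v). (u @ v) ! j \<le> \<delta> (Suc j)"
    using assms(1) unfolding cliffs_def by (rule CollectD)
  from spec[OF this, of "length u + i"] show ?thesis
    using assms(2) by simp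
qed

lemma cliff_red_le: "cliff_red \<delta> v \<preceq> v"
  by (simp add: word_le_def cliff_red_def)

lemma cliff_over_in_cliffs:
  assumes "u @ v' \<in> cliffs \<delta>" and "cliff_red \<delta> v' = v"
  shows "cliff_over u v \<in> cliffs \<delta>"
proof -
  have "u @ v \<preceq> u @ v'"
    using cliff_red_le assms(2) by (auto simp: word_le_append_same_prefix)
  with assms(1) show ?thesis
    unfolding cliff_over_def by (rule cliffs_downward_closed)
qed

lemma min_eq_iff_interval:
  fixes a b d e :: "'a::linorder"
  assumes "b \<le> d" and "a \<le> e"
  shows "min a d = b \<longleftrightarrow> b \<le> a \<and> a \<le> (if b = d then e else b)"
  using assms by (auto simp: min_def)

text \<open>
  The hypothesis \<open>u @ v' \<in> cliffs \<delta>\<close> supplies the upper bound where the letter of \<open>v\<close> is saturated: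
  truncation alone puts no upper bound on the letters over \<open>\<delta> i\<close>.
\<close>

lemma cliff_red_eq_iff_interval:
  assumes v: "v \<in> cliffs \<delta>" and uv': "u @ v' \<in> cliffs \<delta>"
  shows "cliff_red \<delta> v' = v \<longleftrightarrow> cliff_over u v \<preceq> u @ v' \<and> u @ v' \<preceq> cliff_under \<delta> u v"
proof -
  let ?top = "\<lambda>i. if v ! i = \<delta> (Suc i) then \<delta> (length u + Suc i) else v ! i"
  have "cliff_red \<delta> v' = v \<longleftrightarrow>
      length v' = length v \<and> (\<forall>i<length v. min (v' ! i) (\<delta> (Suc i)) = v ! i)"
    unfolding list_eq_iff_nth_eq[of "cliff_red \<delta> v'" v]
    by (rule conj_cong) (simp_all add: cliff_red_def)
  also have "\<dots> \<longleftrightarrow>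
      length v' = length v \<and> (\<forall>i<length v. v ! i \<le> v' ! i \<and> v' ! i \<le> ?top i)"
  proof (intro conj_cong refl all_cong)
    fix i assume len: "length v' = length v" and i: "i < length v"
    from i have "i < length v'"
      unfolding len .
    then have "v' ! i \<le> \<delta> (length u + Suc i)"
      by (rule cliffs_append_nth_le[OF uv'])
    moreover have "v ! i \<le> \<delta> (Suc i)"
      using v i unfolding cliffs_def by blast
    ultimately show "min (v' ! i) (\<delta> (Suc i)) = v ! i \<longleftrightarrow> v ! i \<le> v' ! i \<and> v' ! i \<le> ?top i"
      by (intro min_eq_iff_interval)
  qed
  also have "\<dots> \<longleftrightarrow> v \<preceq> v' \<and> v' \<preceq> map ?top [0..<length v]"
  proof (cases "length v' = length v")
    case True
    then show ?thesis by (simp add: word_le_def imp_conjR all_conj_distrib cong: conj_cong)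
  next
    case False
    then show ?thesis by (simp add: word_le_def)
  qed
  also have "\<dots> \<longleftrightarrow> cliff_over u v \<preceq> u @ v' \<and> u @ v' \<preceq> cliff_under \<delta> u v"
    by (simp only: cliff_over_def cliff_under_def word_le_append_same_prefix)
  finally show ?thesis .
qed

lemma word_le_cliff_over_prefix:
  assumes "cliff_over u v \<preceq> w" and "w \<preceq> cliff_under \<delta> u v"
  obtains v' where "w = u @ v'"
proof -
  have len: "length w = length u + length v"
    using assms(1) by (simp add: word_le_def cliff_over_def)
  \<comment> \<open>both ends of the interval begin with \<open>u\<close>\<close>
  have "w ! i = u ! i" if i: "i < length u" for i
  proof (rule antisym)
    show "w ! i \<le> u ! i"
      using word_le_nthD[OF assms(2), of i] len i by (simp add: cliff_under_def nth_append)
    show "u ! i \<le> w ! i"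
      using word_le_nthD[OF assms(1), of i] i by (simp add: cliff_over_def nth_append)
  qed
  then have "take (length u) w = u"
    using len by (intro nth_equalityI) auto
  then have "w = u @ drop (length u) w"
    by (metis append_take_drop_id)
  then show ?thesis by (rule that)
qed

lemma cliff_interval_eq_image:
  assumes "v \<in> cliffs \<delta>"
  shows "{w. w \<in> cliffs \<delta> \<and> cliff_over u v \<preceq> w \<and> w \<preceq> cliff_under \<delta> u v} =
    (@) u ` {v'. cliff_red \<delta> v' = v \<and> u @ v' \<in> cliffs \<delta>}"
proof (intro equalityI subsetI)
  fix w assume "w \<in> {w. w \<in> cliffs \<delta> \<and> cliff_over u v \<preceq> w \<and> w \<preceq> cliff_under \<delta> u v}"
  then have w: "w \<in> cliffs \<delta>" "cliff_over u v \<preceq> w" "w \<preceq> cliff_under \<delta> u v" by auto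
  obtain v' where "w = u @ v'"
    using w(2,3) by (rule word_le_cliff_over_prefix)
  with w show "w \<in> (@) u ` {v'. cliff_red \<delta> v' = v \<and> u @ v' \<in> cliffs \<delta>}"
    using cliff_red_eq_iff_interval[OF assms, of u v'] by simp
next
  fix w assume "w \<in> (@) u ` {v'. cliff_red \<delta> v' = v \<and> u @ v' \<in> cliffs \<delta>}"
  then obtain v' where "w = u @ v'" "cliff_red \<delta> v' = v" "u @ v' \<in> cliffs \<delta>"
    by auto
  then show "w \<in> {w. w \<in> cliffs \<delta> \<and> cliff_over u v \<preceq> w \<and> w \<preceq> cliff_under \<delta> u v}"
    using cliff_red_eq_iff_interval[OF assms, of u v'] by simp
qed

theorem theorem3p1p2:
  fixes \<delta> :: "nat \<Rightarrow> nat" and u v :: "nat list"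
  assumes "u \<in> cliffs \<delta>" and "v \<in> cliffs \<delta>"
  shows "(cliff_over u v \<in> cliffs \<delta> \<longrightarrow>
            cliff_mult \<delta> (FF u) (FF v) =
              (\<Sum>w | w \<in> cliffs \<delta> \<and> cliff_over u v \<preceq> w \<and> w \<preceq> cliff_under \<delta> u v.
                 (FF w :: nat list \<Rightarrow>\<^sub>0 'k::field_char_0)))
       \<and> (cliff_over u v \<notin> cliffs \<delta> \<longrightarrow>
            cliff_mult \<delta> (FF u) (FF v) = (0 :: nat list \<Rightarrow>\<^sub>0 'k))"
proof (intro conjI impI)
  let ?V = "{v'. cliff_red \<delta> v' = v \<and> u @ v' \<in> cliffs \<delta>}"
  have mult: "cliff_mult \<delta> (FF u) (FF v) = (\<Sum>v'\<in>?V. (FF (u @ v') :: nat list \<Rightarrow>\<^sub>0 'k))"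
    by (simp only: cliff_mult_FF cliff_basis_mult_def)
  have "(\<Sum>w\<in>(@) u ` ?V. (FF w :: nat list \<Rightarrow>\<^sub>0 'k)) = (\<Sum>v'\<in>?V. FF (u @ v'))"
    by (subst sum.reindex) (simp_all add: inj_on_def)
  with mult show "cliff_mult \<delta> (FF u) (FF v) =
      (\<Sum>w | w \<in> cliffs \<delta> \<and> cliff_over u v \<preceq> w \<and> w \<preceq> cliff_under \<delta> u v.
         (FF w :: nat list \<Rightarrow>\<^sub>0 'k))"
    by (simp only: cliff_interval_eq_image[OF assms(2)])
  assume "cliff_over u v \<notin> cliffs \<delta>"
  then have "?V = {}"
    using cliff_over_in_cliffs by blast
  with mult show "cliff_mult \<delta> (FF u) (FF v) = (0 :: nat list \<Rightarrow>\<^sub>0 'k)"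
    by (simp only: sum.empty)
qed

end
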